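(* Assume $f:H\to H$ admits a power series representation $$f(q) := g(\tilde q) := \sum_{n=-\infty}^{\infty} a_n\,\tilde q^{\,n}\qquad\text{for } R_1\le |\tilde q|\le R_2,$$ with each $a_n$ a quaternion constant, $\tilde q = q-q_0$, and $R_1,R_2>0$ some constants, and let $f'(q):=\sum_{n=-\infty}^{\infty} n\,a_n\,\tilde q^{\,n-1}$ be the derivative in the usual sense. If $q_0$ is a real number, then $$\frac{\partial f(q)}{\partial q}\to f'(q)$$ when $q\to R(q)$, i.e., when $q$ approaches a real number.
   Context: $H$ denotes the non-commutative real algebra of quaternions $q=q_a+q_bi+q_cj+q_dk$ ($q_a,q_b,q_c,q_d\in\mathbb{R}$), with real part $R(q)=q_a$, conjugate $q^*=q_a-q_bi-q_cj-q_dk$ and $|q|^2=qq^*$. A function $f:H\to H$ is viewed as a function of the four real variables $q_a,q_b,q_c,q_d$, with quaternion-valued partial derivatives $\partial f/\partial q_a,\dots,\partial f/\partial q_d$. The (left) restricted HR derivative of $f$ with respect to $q$ is $$\frac{\partial f}{\partial q}:=\frac14\left(\frac{\partial f}{\partial q_a}-\frac{\partial f}{\partial q_b}i-\frac{\partial f}{\partial q_c}j-\frac{\partial f}{\partial q_d}k\right).$$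
   Formalization: The real number that q approaches is taken strictly inside the annulus (R1 < |x − q0| < R2); at real points on its boundary the claim can fail, since f is unconstrained outside and f' may diverge there (e.g. the series of q^n/n^2 at q = 1 = R2). *)

theory Defs
  imports "HOL-Analysis.Analysis"
begin

section \<open>The algebra of quaternions\<close>

datatype quat = Quat (qa: real) (qb: real) (qc: real) (qd: real)

lemma quat_eq_iff: "x = y \<longleftrightarrow> qa x = qa y \<and> qb x = qb y \<and> qc x = qc y \<and> qd x = qd y"
  by (auto intro: quat.expand)

definition quat_i :: quat where "quat_i = Quat 0 1 0 0"
definition quat_j :: quat where "quat_j = Quat 0 0 1 0"
definition quat_k :: quat where "quat_k = Quat 0 0 0 1"

definition qcnj :: "quat \<Rightarrow> quat" where
  "qcnj x = Quat (qa x) (- qb x) (- qc x) (- qd x)"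

lemma quat_units_simps [simp]:
  "qa quat_i = 0" "qb quat_i = 1" "qc quat_i = 0" "qd quat_i = 0"
  "qa quat_j = 0" "qb quat_j = 0" "qc quat_j = 1" "qd quat_j = 0"
  "qa quat_k = 0" "qb quat_k = 0" "qc quat_k = 0" "qd quat_k = 1"
  by (simp_all add: quat_i_def quat_j_def quat_k_def)

lemma qcnj_simps [simp]:
  "qa (qcnj x) = qa x" "qb (qcnj x) = - qb x" "qc (qcnj x) = - qc x" "qd (qcnj x) = - qd x"
  by (simp_all add: qcnj_def)

instantiation quat :: ab_group_add
begin

definition "0 = Quat 0 0 0 0"
definition "x + y = Quat (qa x + qa y) (qb x + qb y) (qc x + qc y) (qd x + qd y)"
definition "- x = Quat (- qa x) (- qb x) (- qc x) (- qd x)"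
definition "x - y = Quat (qa x - qa y) (qb x - qb y) (qc x - qc y) (qd x - qd y)"

instance
  by standard
    (simp_all add: quat_eq_iff zero_quat_def plus_quat_def uminus_quat_def minus_quat_def)

end

lemma quat_additive_simps [simp]:
  "qa 0 = 0" "qb 0 = 0" "qc 0 = 0" "qd 0 = 0"
  "qa (x + y) = qa x + qa y" "qb (x + y) = qb x + qb y"
  "qc (x + y) = qc x + qc y" "qd (x + y) = qd x + qd y"
  "qa (- x) = - qa x" "qb (- x) = - qb x" "qc (- x) = - qc x" "qd (- x) = - qd x"
  "qa (x - y) = qa x - qa y" "qb (x - y) = qb x - qb y"
  "qc (x - y) = qc x - qc y" "qd (x - y) = qd x - qd y"
  by (simp_all add: zero_quat_def plus_quat_def uminus_quat_def minus_quat_def)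

instantiation quat :: ring_1
begin

definition "1 = Quat 1 0 0 0"
definition "x * y = Quat
  (qa x * qa y - qb x * qb y - qc x * qc y - qd x * qd y)
  (qa x * qb y + qb x * qa y + qc x * qd y - qd x * qc y)
  (qa x * qc y - qb x * qd y + qc x * qa y + qd x * qb y)
  (qa x * qd y + qb x * qc y - qc x * qb y + qd x * qa y)"

instance
  by standard (simp_all add: quat_eq_iff one_quat_def times_quat_def algebra_simps)

end

lemma quat_multiplicative_simps [simp]:
  "qa 1 = 1" "qb 1 = 0" "qc 1 = 0" "qd 1 = 0"
  "qa (x * y) = qa x * qa y - qb x * qb y - qc x * qc y - qd x * qd y"
  "qb (x * y) = qa x * qb y + qb x * qa y + qc x * qd y - qd x * qc y"
  "qc (x * y) = qa x * qc y - qb x * qd y + qc x * qa y + qd x * qb y"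
  "qd (x * y) = qa x * qd y + qb x * qc y - qc x * qb y + qd x * qa y"
  by (simp_all add: one_quat_def times_quat_def)

lemma quat_units_mult:
  "quat_i * quat_i = - 1" "quat_j * quat_j = - 1" "quat_k * quat_k = - 1"
  "quat_i * quat_j = quat_k" "quat_j * quat_k = quat_i" "quat_k * quat_i = quat_j"
  "quat_j * quat_i = - quat_k" "quat_k * quat_j = - quat_i" "quat_i * quat_k = - quat_j"
  by (simp_all add: quat_eq_iff)

instantiation quat :: real_algebra_1
begin

definition "r *\<^sub>R x = Quat (r * qa x) (r * qb x) (r * qc x) (r * qd x)"

instance
  by standard (simp_all add: quat_eq_iff scaleR_quat_def algebra_simps)

end

lemma quat_scaleR_simps [simp]:
  "qa (r *\<^sub>R x) = r * qa x" "qb (r *\<^sub>R x) = r * qb x"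
  "qc (r *\<^sub>R x) = r * qc x" "qd (r *\<^sub>R x) = r * qd x"
  by (simp_all add: scaleR_quat_def)

lemma quat_of_real_simps [simp]:
  "qa (of_real r) = r" "qb (of_real r) = 0" "qc (of_real r) = 0" "qd (of_real r) = 0"
  by (simp_all add: of_real_def)

instantiation quat :: real_inner
begin

definition "inner x y = qa x * qa y + qb x * qb y + qc x * qc y + qd x * qd y"
definition "norm (x::quat) = sqrt ((qa x)\<^sup>2 + (qb x)\<^sup>2 + (qc x)\<^sup>2 + (qd x)\<^sup>2)"
definition "sgn (x::quat) = x /\<^sub>R norm x"
definition "dist (x::quat) y = norm (x - y)"
definition [code del]:
  "(uniformity :: (quat \<times> quat) filter) = (INF e\<in>{0<..}. principal {(x, y). dist x y < e})"
definition [code del]: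
  "open (U :: quat set) \<longleftrightarrow> (\<forall>x\<in>U. eventually (\<lambda>(x', y). x' = x \<longrightarrow> y \<in> U) uniformity)"

instance
proof
  fix x y z :: quat and r :: real
  show "inner x x = 0 \<longleftrightarrow> x = 0"
    unfolding inner_quat_def quat_eq_iff
    by (simp add: add_nonneg_eq_0_iff)
  show "norm x = sqrt (inner x x)"
    by (simp add: norm_quat_def inner_quat_def power2_eq_square)
  show "inner x y = inner y x"
    by (simp add: inner_quat_def mult.commute)
  show "inner (x + y) z = inner x z + inner y z" "inner (r *\<^sub>R x) y = r * inner x y"
    by (simp_all add: inner_quat_def algebra_simps)
  show "0 \<le> inner x x"
    by (simp add: inner_quat_def)
qed (rule sgn_quat_def dist_quat_def uniformity_quat_def open_quat_def)+

end

lemma quat_norm_power2: "(norm x)\<^sup>2 = (qa x)\<^sup>2 + (qb x)\<^sup>2 + (qc x)\<^sup>2 + (qd x)\<^sup>2"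
  unfolding norm_quat_def by (rule real_sqrt_pow2) (intro add_nonneg_nonneg zero_le_power2)

lemma quat_mult_qcnj: "x * qcnj x = of_real ((norm x)\<^sup>2)"
  by (simp add: quat_eq_iff quat_norm_power2, simp add: power2_eq_square)

instantiation quat :: real_normed_div_algebra
begin

definition "inverse x = qcnj x /\<^sub>R (norm x)\<^sup>2"
definition "x div (y::quat) = x * inverse y"

instance
proof
  fix x y :: quat
  have nz: "(norm x)\<^sup>2 \<noteq> 0" if "x \<noteq> 0" using that by simp
  show "inverse x * x = 1" if "x \<noteq> 0"
  proof -
    have "qcnj x * x = of_real ((norm x)\<^sup>2)"
      by (simp add: quat_eq_iff quat_norm_power2, simp add: power2_eq_square)
    then show ?thesis using nz[OF that]
      by (simp add: inverse_quat_def of_real_def)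
  qed
  show "x * inverse x = 1" if "x \<noteq> 0"
    using nz[OF that] by (simp add: inverse_quat_def quat_mult_qcnj of_real_def)
  show "norm (x * y) = norm x * norm y"
    unfolding norm_quat_def real_sqrt_mult [symmetric]
    by (rule arg_cong[where f = sqrt]) (simp add: power2_eq_square algebra_simps)
  show "inverse 0 = (0::quat)" by (simp add: inverse_quat_def)
qed (rule divide_quat_def)

end

instantiation quat :: euclidean_space
begin

definition "Basis = {1, quat_i, quat_j, quat_k}"

instance
proof
  have neq: "1 \<noteq> quat_i" "1 \<noteq> quat_j" "1 \<noteq> quat_k" "quat_i \<noteq> quat_j" "quat_i \<noteq> quat_k" "quat_j \<noteq> quat_k"
    by (simp_all add: quat_eq_iff)
  fix x u v :: quat
  show "(Basis :: quat set) \<noteq> {}" "finite (Basis :: quat set)"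
    by (simp_all add: Basis_quat_def)
  show "inner u v = (if u = v then 1 else 0)" if "u \<in> Basis" "v \<in> Basis"
    using that unfolding Basis_quat_def
    by (elim insertE emptyE; simp add: inner_quat_def neq neq [symmetric])
  show "(\<forall>u\<in>Basis. inner x u = 0) \<longleftrightarrow> x = 0"
    by (simp add: Basis_quat_def inner_quat_def quat_eq_iff [of x 0])
qed

end


section \<open>The left restricted HR derivative\<close>

definition partial_deriv :: "(quat \<Rightarrow> quat) \<Rightarrow> quat \<Rightarrow> quat \<Rightarrow> quat" where
  "partial_deriv f u q = vector_derivative (\<lambda>t. f (q + t *\<^sub>R u)) (at 0)"

definition has_partial_derivs :: "(quat \<Rightarrow> quat) \<Rightarrow> quat \<Rightarrow> bool" where
  "has_partial_derivs f q \<longleftrightarrow>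
     (\<forall>u\<in>{1, quat_i, quat_j, quat_k}. (\<lambda>t::real. f (q + t *\<^sub>R u)) differentiable (at 0))"

text \<open>Meaningful only at points with \<^term>\<open>has_partial_derivs f q\<close>.
  The imaginary units multiply the partial derivatives from the right.\<close>

definition HR_deriv :: "(quat \<Rightarrow> quat) \<Rightarrow> quat \<Rightarrow> quat" where
  "HR_deriv f q = (1 / 4) *\<^sub>R
     (partial_deriv f 1 q - partial_deriv f quat_i q * quat_i
      - partial_deriv f quat_j q * quat_j - partial_deriv f quat_k q * quat_k)"


section \<open>Two-sided series\<close>

text \<open>As usual for Laurent series, a series over all integers converges when its
  nonnegative and its negative parts converge separately, not necessarily absolutely.\<close>

definition int_sums :: "(int \<Rightarrow> 'a::real_normed_vector) \<Rightarrow> 'a \<Rightarrow> bool" where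
  "int_sums u s \<longleftrightarrow>
     (\<exists>s1 s2. (\<lambda>n. u (int n)) sums s1 \<and> (\<lambda>n. u (- int (Suc n))) sums s2 \<and> s = s1 + s2)"

definition int_summable :: "(int \<Rightarrow> 'a::real_normed_vector) \<Rightarrow> bool" where
  "int_summable u \<longleftrightarrow> (\<exists>s. int_sums u s)"

definition int_suminf :: "(int \<Rightarrow> 'a::real_normed_vector) \<Rightarrow> 'a" where
  "int_suminf u = (THE s. int_sums u s)"

lemma int_suminf_eqI: "int_sums u s \<Longrightarrow> int_suminf u = s"
  unfolding int_suminf_def int_sums_def
  by (rule the_equality) (auto dest: sums_unique2)

definition laurent_term :: "(int \<Rightarrow> quat) \<Rightarrow> quat \<Rightarrow> quat \<Rightarrow> int \<Rightarrow> quat" where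
  "laurent_term a q0 q n = a n * (q - q0) powi n"

definition laurent_deriv_term :: "(int \<Rightarrow> quat) \<Rightarrow> quat \<Rightarrow> quat \<Rightarrow> int \<Rightarrow> quat" where
  "laurent_deriv_term a q0 q n = of_int n * a n * (q - q0) powi (n - 1)"

definition laurent_deriv :: "(int \<Rightarrow> quat) \<Rightarrow> quat \<Rightarrow> quat \<Rightarrow> quat" where
  "laurent_deriv a q0 q = int_suminf (laurent_deriv_term a q0 q)"

end

theory Submission
  imports Defs
begin

text \<open>
  Put \<open>z = q - q0\<close>. On the annulus \<open>f q\<close> is \<open>A z + B (inverse z)\<close> for two ordinary power
  series \<open>A\<close> and \<open>B\<close> with coefficients on the left, the first converging on the outer sphere,
  the second, in \<open>inverse z\<close>, on the inner one.

  Since multiplication does not commute, the derivative of \<open>z ^ n\<close> in direction \<open>h\<close> is the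
  sum of all \<open>z ^ k * h * z ^ (n - 1 - k)\<close>. Its norm is nevertheless at most that of the
  commutative formula, \<open>n * norm z ^ (n - 1) * norm h\<close>, so the classical majorant justifies
  differentiation term by term (\<open>has_derivative_power_series\<close>) and shows that the derivative
  is continuous in the point and the direction (\<open>isCont_power_series_deriv\<close>). By the chain
  rule, \<open>f\<close> has a Frechet derivative \<open>D q\<close> on the open annulus, continuous in \<open>q\<close>.

  If \<open>h\<close> commutes with \<open>z\<close>, the sum above collapses to \<open>n * z ^ (n - 1) * h\<close>. This is used
  twice. The direction \<open>1\<close> commutes with everything, so the formal derivative of the Laurent
  series equals \<open>D q 1\<close> at every point of the annulus (\<open>int_sums_laurent_deriv_term\<close>), and is
  therefore continuous there. A real point \<open>x\<close> makes \<open>z\<close> commute with every direction, so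
  \<open>D x h = D x 1 * h\<close> (\<open>laurent_total_deriv_real\<close>); as \<open>u * u = - 1\<close> for the three imaginary
  units, each of the four terms of the HR derivative then contributes \<open>D x 1 / 4\<close>. Thus the HR
  derivative and the formal derivative agree at \<open>x\<close>, and by continuity both have their common
  value as limit there.
\<close>


section \<open>Powers in a noncommutative division algebra\<close>

text \<open>
  The noncommutative Leibniz sum \<open>\<Sum>k<n. z ^ k * h * z ^ (n - 1 - k)\<close>, in the recursive form
  that the product rule gives for \<open>z * z ^ n\<close>.
\<close>

primrec power_deriv :: "nat \<Rightarrow> 'a::ring_1 \<Rightarrow> 'a \<Rightarrow> 'a" where
  "power_deriv 0 z h = 0"
| "power_deriv (Suc n) z h = h * z ^ n + z * power_deriv n z h"

lemma has_derivative_power_deriv: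
  fixes z :: "'a::real_normed_algebra_1"
  shows "((\<lambda>z. z ^ n) has_derivative power_deriv n z) (at z within S)"
proof (induction n)
  case 0
  have "power_deriv 0 z = (\<lambda>h. 0)" by (rule ext) simp
  then show ?case by simp
next
  case (Suc n)
  have "((\<lambda>z. z * z ^ n) has_derivative (\<lambda>h. z * power_deriv n z h + h * z ^ n)) (at z within S)"
    by (rule has_derivative_mult [OF has_derivative_ident Suc])
  moreover have "power_deriv (Suc n) z = (\<lambda>h. z * power_deriv n z h + h * z ^ n)"
    by (rule ext) (simp add: add.commute)
  ultimately show ?case by simp
qed

lemma norm_power_deriv_le:
  fixes z :: "'a::real_normed_div_algebra"
  shows "norm (power_deriv n z h) \<le> of_nat n * norm z ^ (n - 1) * norm h"
proof (induction n)
  case (Suc n)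
  have "norm (power_deriv (Suc n) z h) \<le> norm h * norm z ^ n + norm z * norm (power_deriv n z h)"
    using norm_triangle_ineq [of "h * z ^ n" "z * power_deriv n z h"]
    by (simp add: norm_mult norm_power)
  also have "\<dots> \<le> norm h * norm z ^ n + norm z * (of_nat n * norm z ^ (n - 1) * norm h)"
    by (intro add_left_mono mult_left_mono Suc norm_ge_zero)
  also have "\<dots> = of_nat (Suc n) * norm z ^ (Suc n - 1) * norm h"
    by (cases n) (simp_all add: algebra_simps)
  finally show ?case .
qed simp

text \<open>
  When \<open>h\<close> can be moved past \<open>z\<close>, all \<open>n\<close> summands are equal. The two uses are \<open>h = 1\<close> and
  real \<open>z\<close>.
\<close>

lemma power_deriv_commuting:
  assumes "z * h = h * z"
  shows "power_deriv n z h = of_nat n * z ^ (n - 1) * h"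
proof (induction n)
  case (Suc n)
  have "h * z ^ n = z ^ n * h"
    using assms by (metis power_commuting_commutes)
  moreover have "z * (of_nat n * z ^ (n - 1) * h) = of_nat n * z ^ n * h"
  proof (cases n)
    case (Suc m)
    have "z * (of_nat n * (z ^ m * h)) = of_nat n * (z * (z ^ m * h))"
      by (metis mult_of_nat_commute mult.assoc)
    then show ?thesis by (simp add: Suc mult.assoc del: of_nat_Suc)
  qed simp
  ultimately show ?case
    using Suc by (simp add: algebra_simps)
qed simp

lemma continuous_on_power_deriv:
  "continuous_on S (\<lambda>(z, h). power_deriv n z (h::'a::real_normed_algebra_1))"
proof (induction n)
  case (Suc n)
  then show ?case
    unfolding case_prod_unfold power_deriv.simps by (intro continuous_intros)
qed (simp add: case_prod_unfold)


section \<open>Power series with left coefficients\<close>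

definition power_series :: "(nat \<Rightarrow> 'a) \<Rightarrow> 'a \<Rightarrow> 'a::real_normed_algebra_1" where
  "power_series b z = (\<Sum>n. b n * z ^ n)"

definition power_series_deriv :: "(nat \<Rightarrow> 'a) \<Rightarrow> 'a \<Rightarrow> 'a \<Rightarrow> 'a::real_normed_algebra_1" where
  "power_series_deriv b z h = (\<Sum>n. b n * power_deriv n z h)"

text \<open>
  Convergence at a single point \<open>x\<close> gives absolute convergence inside its sphere; this makes
  \<open>\<Sum>n. norm (b n) * t ^ n\<close> a real power series whose formal derivative again converges for
  \<open>\<bar>t\<bar> < norm x\<close>.
\<close>

lemma summable_derivative_majorant:
  fixes b :: "nat \<Rightarrow> 'a::real_normed_div_algebra"
  assumes "summable (\<lambda>n. b n * x ^ n)" and "0 \<le> r" and "r < norm x"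
  shows "summable (\<lambda>n. norm (b n) * (of_nat n * r ^ (n - 1)))"
proof -
  have "summable (\<lambda>n. norm (b n) * t ^ n)" if "norm t < norm x" for t :: real
  proof -
    have "summable (\<lambda>n. norm (b n * of_real t ^ n))"
      using powser_insidea [OF assms(1), of "of_real t"] that by simp
    then show ?thesis
      using summable_norm_cancel [of "\<lambda>n. norm (b n) * t ^ n"]
      by (simp add: norm_mult norm_power abs_mult power_abs)
  qed
  then have "summable (\<lambda>n. diffs (\<lambda>n. norm (b n)) n * r ^ n)"
    by (rule termdiff_converges [where K = "norm x", rotated]) (use assms in auto)
  then have "summable (\<lambda>n. norm (b (Suc n)) * (of_nat (Suc n) * r ^ (Suc n - 1)))"
    by (simp add: diffs_def mult_ac)
  then show ?thesis
    using summable_Suc_iff [of "\<lambda>n. norm (b n) * (of_nat n * r ^ (n - 1))"] by simp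
qed

lemma norm_derivative_term_le:
  fixes b :: "nat \<Rightarrow> 'a::real_normed_div_algebra"
  assumes "norm z \<le> r"
  shows "norm (b n * power_deriv n z h) \<le> norm (b n) * (of_nat n * r ^ (n - 1)) * norm h"
proof -
  have "norm (power_deriv n z h) \<le> of_nat n * norm z ^ (n - 1) * norm h"
    by (rule norm_power_deriv_le)
  also have "\<dots> \<le> of_nat n * r ^ (n - 1) * norm h"
    using assms by (intro mult_right_mono mult_left_mono power_mono) auto
  finally show ?thesis
    by (simp add: norm_mult mult.assoc mult_left_mono)
qed

lemma power_series_deriv_sums:
  fixes b :: "nat \<Rightarrow> 'a::{real_normed_div_algebra, banach}"
  assumes "summable (\<lambda>n. b n * x ^ n)" and "norm z < norm x"
  shows "(\<lambda>n. b n * power_deriv n z h) sums power_series_deriv b z h"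
  unfolding power_series_deriv_def
proof (rule summable_sums [OF summable_comparison_test'])
  show "summable (\<lambda>n. norm (b n) * (of_nat n * norm z ^ (n - 1)) * norm h)"
    using assms by (intro summable_mult2 summable_derivative_majorant) auto
qed (rule norm_derivative_term_le [OF order_refl])

text \<open>
  On a slightly smaller ball, which is convex, the tails of the differentiated series are at
  most \<open>norm h\<close> times the tails of one convergent real series; this is the uniformity in point
  and direction that termwise Frechet differentiation asks for.
\<close>

lemma has_derivative_power_series:
  fixes b :: "nat \<Rightarrow> 'a::{real_normed_div_algebra, banach}"
  assumes sm: "summable (\<lambda>n. b n * x ^ n)" and z: "norm z < norm x"
  shows "(power_series b has_derivative power_series_deriv b z) (at z)"
proof -
  define r where "r = (norm z + norm x) / 2"
  have r: "norm z < r" "0 \<le> r" "r < norm x"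
    using z unfolding r_def by (auto intro: add_nonneg_nonneg)
  define M where "M = (\<lambda>n. norm (b n) * (of_nat n * r ^ (n - 1)))"
  have M: "summable M"
    unfolding M_def using sm r by (intro summable_derivative_majorant)
  have le: "norm (b n * power_deriv n w h) \<le> M n * norm h" if "w \<in> ball 0 r" for n w h
    unfolding M_def using that by (intro norm_derivative_term_le) auto
  have unif: "\<forall>\<^sub>F n in sequentially. \<forall>w\<in>ball 0 r. \<forall>h.
      norm ((\<Sum>i<n. b i * power_deriv i w h) - power_series_deriv b w h) \<le> e * norm h"
    if e: "e > 0" for e
  proof -
    obtain N where N: "\<And>n. n \<ge> N \<Longrightarrow> norm (\<Sum>i. M (i + n)) < e"
      using suminf_exist_split [OF e M] by blast
    have "norm ((\<Sum>i<n. b i * power_deriv i w h) - power_series_deriv b w h) \<le> e * norm h"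
      if n: "n \<ge> N" and w: "w \<in> ball 0 r" for n w h
    proof -
      have sums: "(\<lambda>i. b i * power_deriv i w h) sums power_series_deriv b w h"
        using sm w r by (intro power_series_deriv_sums) auto
      have tail: "summable (\<lambda>i. M (i + n))"
        using M by (simp add: summable_iff_shift)
      have "norm ((\<Sum>i<n. b i * power_deriv i w h) - power_series_deriv b w h)
          = norm (\<Sum>i. b (i + n) * power_deriv (i + n) w h)"
        using suminf_minus_initial_segment [OF sums_summable [OF sums], of n]
        by (simp add: power_series_deriv_def norm_minus_commute)
      also have "\<dots> \<le> (\<Sum>i. M (i + n) * norm h)"
        using le [OF w] tail by (intro norm_suminf_le summable_mult2)
      also have "\<dots> = (\<Sum>i. M (i + n)) * norm h"
        by (rule suminf_mult2 [OF tail, symmetric])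
      also have "\<dots> \<le> e * norm h"
        using N [OF n] by (intro mult_right_mono) auto
      finally show ?thesis .
    qed
    then show ?thesis
      unfolding eventually_sequentially by blast
  qed
  have "\<exists>g. \<forall>w\<in>ball 0 r. (\<lambda>n. b n * w ^ n) sums g w \<and>
      (g has_derivative power_series_deriv b w) (at w within ball 0 r)"
  proof (rule has_derivative_series [where f' = "\<lambda>n w h. b n * power_deriv n w h"])
    show "((\<lambda>w. b n * w ^ n) has_derivative (\<lambda>h. b n * power_deriv n w h)) (at w within ball 0 r)"
      for n w by (rule has_derivative_mult_right [OF has_derivative_power_deriv])
    show "z \<in> ball 0 r" using r by simp
    show "(\<lambda>n. b n * z ^ n) sums (\<Sum>n. b n * z ^ n)"
      using powser_inside [OF sm z] by (rule summable_sums)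
  qed (use unif in auto)
  then obtain g where g: "\<And>w. w \<in> ball 0 r \<Longrightarrow> (\<lambda>n. b n * w ^ n) sums g w"
    "\<And>w. w \<in> ball 0 r \<Longrightarrow> (g has_derivative power_series_deriv b w) (at w within ball 0 r)"
    by blast
  have "(g has_derivative power_series_deriv b z) (at z)"
    using g(2) [of z] r(1) at_within_open [of z "ball 0 r"] by simp
  then show ?thesis
  proof (rule has_derivative_transform_within_open)
    show "g w = power_series b w" if "w \<in> ball 0 r" for w
      using g(1) [OF that] by (simp add: power_series_def sums_iff)
  qed (use r in auto)
qed

text \<open>
  The continuity is joint because in the principal part of a Laurent series the direction
  \<open>inverse z * h * inverse z\<close> varies with the point. The M-test applies once the direction is
  confined to a bounded set.
\<close>

lemma isCont_power_series_deriv: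
  fixes b :: "nat \<Rightarrow> 'a::{real_normed_div_algebra, banach}"
  assumes sm: "summable (\<lambda>n. b n * x ^ n)" and z: "norm z < norm x"
  shows "isCont (\<lambda>(w, k). power_series_deriv b w k) (z, h)"
proof -
  define r where "r = (norm z + norm x) / 2"
  have r: "norm z < r" "0 \<le> r" "r < norm x"
    using z unfolding r_def by (auto intro: add_nonneg_nonneg)
  define A where "A = ball (0::'a) r \<times> ball (0::'a) (norm h + 1)"
  have "uniform_limit A (\<lambda>n p. \<Sum>i<n. b i * power_deriv i (fst p) (snd p))
      (\<lambda>p. \<Sum>i. b i * power_deriv i (fst p) (snd p)) sequentially"
  proof (rule Weierstrass_m_test)
    show "summable (\<lambda>n. norm (b n) * (of_nat n * r ^ (n - 1)) * (norm h + 1))"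
      using sm r by (intro summable_mult2 summable_derivative_majorant)
    show "norm (b n * power_deriv n (fst p) (snd p))
        \<le> norm (b n) * (of_nat n * r ^ (n - 1)) * (norm h + 1)" if "p \<in> A" for n p
    proof (rule order_trans [OF norm_derivative_term_le])
      show "norm (b n) * (of_nat n * r ^ (n - 1)) * norm (snd p)
          \<le> norm (b n) * (of_nat n * r ^ (n - 1)) * (norm h + 1)"
        using that r by (intro mult_left_mono) (auto simp: A_def)
    qed (use that in \<open>auto simp: A_def\<close>)
  qed
  then have "continuous_on A (\<lambda>p. \<Sum>i. b i * power_deriv i (fst p) (snd p))"
    by (rule uniform_limit_theorem [rotated])
      (auto intro!: always_eventually continuous_intros
        continuous_on_power_deriv [unfolded case_prod_unfold])
  moreover have "open A" "(z, h) \<in> A"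
    using r by (auto simp: A_def open_Times)
  ultimately show ?thesis
    unfolding case_prod_unfold power_series_deriv_def
    using continuous_on_eq_continuous_at by blast
qed

lemma power_series_deriv_commuting:
  fixes b :: "nat \<Rightarrow> 'a::{real_normed_div_algebra, banach}"
  assumes sm: "summable (\<lambda>n. b n * x ^ n)" and z: "norm z < norm x" and "z * h = h * z"
  shows "power_series_deriv b z h = power_series_deriv b z 1 * h"
proof -
  have "(\<lambda>n. b n * power_deriv n z h) = (\<lambda>n. b n * power_deriv n z 1 * h)"
    using assms(3) by (simp add: power_deriv_commuting mult.assoc)
  then have "(\<lambda>n. b n * power_deriv n z h) sums (power_series_deriv b z 1 * h)"
    using sums_mult2 [OF power_series_deriv_sums [OF sm z, of 1], of h] by simp
  with power_series_deriv_sums [OF sm z, of h] show ?thesis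
    by (rule sums_unique2)
qed


section \<open>The HR derivative of a Frechet differentiable function\<close>

lemma partial_deriv_has_vector_derivative:
  assumes "(f has_derivative D) (at q)"
  shows "((\<lambda>t. f (q + t *\<^sub>R u)) has_vector_derivative D u) (at 0)"
proof -
  have "((\<lambda>t. q + t *\<^sub>R u) has_derivative (\<lambda>t. t *\<^sub>R u)) (at (0::real))"
    by (auto intro!: derivative_eq_intros)
  then have "((\<lambda>t. f (q + t *\<^sub>R u)) has_derivative (\<lambda>t. D (t *\<^sub>R u))) (at 0)"
    by (rule has_derivative_compose) (use assms in simp)
  then show ?thesis
    using linear_scale [OF has_derivative_linear [OF assms]]
    by (simp add: has_vector_derivative_def)
qed

lemma has_derivative_imp_has_partial_derivs:
  assumes "(f has_derivative D) (at q)"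
  shows "has_partial_derivs f q"
  unfolding has_partial_derivs_def
  using partial_deriv_has_vector_derivative [OF assms]
  by (metis differentiableI_vector)

lemma HR_deriv_eq:
  assumes "(f has_derivative D) (at q)"
  shows "HR_deriv f q = (1 / 4) *\<^sub>R
    (D 1 - D quat_i * quat_i - D quat_j * quat_j - D quat_k * quat_k)"
  unfolding HR_deriv_def partial_deriv_def
  by (simp only: vector_derivative_at [OF partial_deriv_has_vector_derivative [OF assms]])

text \<open>
  For each imaginary unit \<open>u\<close> the hypothesis gives \<open>D u * u = D 1 * (u * u) = - D 1\<close>.
\<close>

lemma HR_deriv_eq_real_partial:
  assumes "(f has_derivative D) (at q)" and "\<And>h. D h = D 1 * h"
  shows "HR_deriv f q = D 1"
proof -
  have "D u * u = - D 1" if "u * u = - 1" for u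
    using assms(2) [of u] that by (simp add: mult.assoc)
  then have "HR_deriv f q = (1 / 4) *\<^sub>R (D 1 + D 1 + D 1 + D 1)"
    by (simp add: HR_deriv_eq [OF assms(1)] quat_units_mult)
  also have "\<dots> = D 1"
    by (simp add: quat_eq_iff)
  finally show ?thesis .
qed


section \<open>Laurent series on an annulus\<close>

text \<open>
  The principal part is read as a power series in \<open>inverse z\<close>. Its constant coefficient is
  set to zero because the term of exponent \<open>0\<close> already belongs to the regular part.
\<close>

definition principal_coeff :: "(int \<Rightarrow> quat) \<Rightarrow> nat \<Rightarrow> quat" where
  "principal_coeff a n = (if n = 0 then 0 else a (- int n))"

text \<open>
  The chain rule for the two parts, the derivative of \<open>inverse\<close> at \<open>z\<close> being
  \<open>\<lambda>h. - (inverse z * h * inverse z)\<close>.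
\<close>

definition laurent_total_deriv :: "(int \<Rightarrow> quat) \<Rightarrow> quat \<Rightarrow> quat \<Rightarrow> quat" where
  "laurent_total_deriv a z h = power_series_deriv (\<lambda>n. a (int n)) z h
     - power_series_deriv (principal_coeff a) (inverse z) (inverse z * h * inverse z)"

lemma principal_part_sums_iff:
  "(\<lambda>n. laurent_term a q0 q (- int (Suc n))) sums s \<longleftrightarrow>
   (\<lambda>n. principal_coeff a n * inverse (q - q0) ^ n) sums s"
proof -
  have "laurent_term a q0 q (- int (Suc n))
      = principal_coeff a (Suc n) * inverse (q - q0) ^ Suc n" for n
    unfolding laurent_term_def principal_coeff_def power_int_minus power_int_of_nat
    by (simp add: power_inverse del: power_Suc of_nat_Suc)
  then show ?thesis
    using sums_Suc_iff [of "\<lambda>n. principal_coeff a n * inverse (q - q0) ^ n" s]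
    by (simp add: principal_coeff_def del: power_Suc)
qed

lemma int_sums_laurent_term_iff:
  "int_sums (laurent_term a q0 q) s \<longleftrightarrow>
   (\<exists>s1 s2. (\<lambda>n. a (int n) * (q - q0) ^ n) sums s1 \<and>
      (\<lambda>n. principal_coeff a n * inverse (q - q0) ^ n) sums s2 \<and> s = s1 + s2)"
  unfolding int_sums_def principal_part_sums_iff by (simp add: laurent_term_def)

text \<open>
  The points \<open>x\<close> and \<open>y\<close> mark an outer and an inner sphere, and only convergence at these two
  points is assumed; the regular part then converges inside the sphere of \<open>x\<close> and the
  principal part outside that of \<open>y\<close>.
\<close>

locale laurent_annulus =
  fixes a :: "int \<Rightarrow> quat" and x y :: quat
  assumes regular: "summable (\<lambda>n. a (int n) * x ^ n)"
    and principal: "summable (\<lambda>n. principal_coeff a n * inverse y ^ n)"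
    and inner_nz: "y \<noteq> 0"
begin

lemma inverse_in_disc:
  fixes z :: quat
  assumes "norm y < norm z"
  shows "z \<noteq> 0" "norm (inverse z) < norm (inverse y)"
proof -
  show nz: "z \<noteq> 0"
    using assms by auto
  show "norm (inverse z) < norm (inverse y)"
    using assms inner_nz nz by (simp add: nonzero_norm_inverse less_imp_inverse_less)
qed

lemma has_derivative_laurent:
  assumes z: "norm y < norm z" "norm z < norm x"
  shows "((\<lambda>z. power_series (\<lambda>n. a (int n)) z + power_series (principal_coeff a) (inverse z))
    has_derivative laurent_total_deriv a z) (at z)"
proof -
  let ?B = "power_series_deriv (principal_coeff a) (inverse z)"
  note nz = inverse_in_disc [OF z(1)]
  have B: "(power_series (principal_coeff a) has_derivative ?B) (at (inverse z))"
    by (rule has_derivative_power_series [OF principal nz(2)])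
  have "((\<lambda>z. power_series (principal_coeff a) (inverse z))
      has_derivative (\<lambda>h. ?B (- (inverse z * h * inverse z)))) (at z)"
    by (rule has_derivative_compose [OF has_derivative_inverse' [OF nz(1)] B])
  then have "((\<lambda>z. power_series (\<lambda>n. a (int n)) z + power_series (principal_coeff a) (inverse z))
      has_derivative (\<lambda>h. power_series_deriv (\<lambda>n. a (int n)) z h
        + ?B (- (inverse z * h * inverse z)))) (at z)"
    by (rule has_derivative_add [OF has_derivative_power_series [OF regular z(2)]])
  moreover have "?B (- k) = - ?B k" for k
    by (rule linear_neg [OF has_derivative_linear [OF B]])
  ultimately show ?thesis
    by (simp add: laurent_total_deriv_def [abs_def])
qed

lemma isCont_laurent_total_deriv:
  assumes z: "norm y < norm z" "norm z < norm x"
  shows "isCont (\<lambda>z. laurent_total_deriv a z h) z"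
proof -
  note nz = inverse_in_disc [OF z(1)]
  have A: "isCont (\<lambda>z. case (z, h) of (w, k) \<Rightarrow> power_series_deriv (\<lambda>n. a (int n)) w k) z"
    by (rule isCont_o2 [where f = "\<lambda>z. (z, h)", OF _ isCont_power_series_deriv [OF regular z(2)]])
      (intro continuous_intros)
  have B: "isCont (\<lambda>z. case (inverse z, inverse z * h * inverse z) of
      (w, k) \<Rightarrow> power_series_deriv (principal_coeff a) w k) z"
    by (rule isCont_o2 [where f = "\<lambda>z. (inverse z, inverse z * h * inverse z)",
          OF _ isCont_power_series_deriv [OF principal nz(2)]])
      (use nz(1) in \<open>intro continuous_intros\<close>)
  show ?thesis
    unfolding laurent_total_deriv_def using continuous_diff [OF A B] by simp
qed

text \<open>
  A real \<open>z\<close> is central, and so is its inverse. Hence \<open>h\<close> can be moved to the right end of every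
  term of both series.
\<close>

lemma laurent_total_deriv_real:
  assumes z: "norm y < norm z" "norm z < norm x" and "z \<in> \<real>"
  shows "laurent_total_deriv a z h = laurent_total_deriv a z 1 * h"
proof -
  note nz = inverse_in_disc [OF z(1)]
  have comm: "z * k = k * z" "inverse z * k = k * inverse z" for k
  proof -
    obtain r where "z = of_real r" using assms(3) by (auto elim: Reals_cases)
    then show "z * k = k * z" by (simp add: of_real_def)
    have "inverse z = of_real (inverse r)"
      using \<open>z = of_real r\<close> by (simp add: of_real_inverse)
    then show "inverse z * k = k * inverse z" by (simp add: of_real_def)
  qed
  have "power_series_deriv (principal_coeff a) (inverse z) k
      = power_series_deriv (principal_coeff a) (inverse z) 1 * k" for k
    by (rule power_series_deriv_commuting [OF principal nz(2) comm(2)])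
  note B = this [of "inverse z * h * inverse z"] this [of "inverse z * 1 * inverse z"]
  have "inverse z * h * inverse z = inverse z * 1 * inverse z * h"
    by (metis comm(2) mult.assoc mult_1_right)
  then show ?thesis
    unfolding laurent_total_deriv_def B
    power_series_deriv_commuting [OF regular z(2) comm(1), of h]
    by (simp add: left_diff_distrib mult.assoc)
qed

text \<open>
  The point is not restricted to be real here: the direction \<open>1\<close> commutes with \<open>z\<close>, and the
  direction \<open>inverse z * 1 * inverse z\<close> in which the principal part is differentiated commutes
  with \<open>inverse z\<close>. The formal derivative is therefore the partial derivative along the
  real axis at every point of the annulus.
\<close>

lemma int_sums_laurent_deriv_term:
  assumes z: "norm y < norm (q - q0)" "norm (q - q0) < norm x"
  shows "int_sums (laurent_deriv_term a q0 q) (laurent_total_deriv a (q - q0) 1)"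
proof -
  define z where "z = q - q0"
  define w where "w = inverse z"
  have nz: "z \<noteq> 0" "norm w < norm (inverse y)"
    using inverse_in_disc [OF z(1)] by (auto simp: z_def w_def)
  have reg: "laurent_deriv_term a q0 q (int n) = a (int n) * power_deriv n z 1" for n
  proof (cases n)
    case (Suc m)
    have "z powi (int n - 1) = z ^ m" by (simp add: Suc)
    then have "laurent_deriv_term a q0 q (int n) = of_nat n * (a (int n) * z ^ m)"
      by (simp add: laurent_deriv_term_def z_def [symmetric] mult.assoc)
    also have "\<dots> = a (int n) * (of_nat n * z ^ m)"
      by (metis mult_of_nat_commute mult.assoc)
    also have "\<dots> = a (int n) * power_deriv n z 1"
      by (simp add: Suc power_deriv_commuting del: of_nat_Suc power_deriv.simps)
    finally show ?thesis .
  qed (simp add: laurent_deriv_term_def)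
  have prin: "laurent_deriv_term a q0 q (- int (Suc n))
      = - (principal_coeff a (Suc n) * power_deriv (Suc n) w (w * w))" for n
  proof -
    have "- int (Suc n) - 1 = - int (n + 2)" by simp
    then have "z powi (- int (Suc n) - 1) = w ^ (n + 2)"
      unfolding w_def by (simp only: power_int_minus power_int_of_nat power_inverse)
    also have "\<dots> = w ^ n * (w * w)"
      by (simp only: power_add power2_eq_square)
    finally have "z powi (- int (Suc n) - 1) = w ^ n * (w * w)" .
    then have "laurent_deriv_term a q0 q (- int (Suc n))
        = - (of_nat (Suc n) * a (- int (Suc n)) * (w ^ n * (w * w)))"
      by (simp add: laurent_deriv_term_def z_def [symmetric] del: of_nat_Suc)
    also have "\<dots> = - (a (- int (Suc n)) * (of_nat (Suc n) * w ^ n * (w * w)))"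
      by (metis mult_of_nat_commute mult.assoc)
    finally show ?thesis
      by (subst power_deriv_commuting)
        (simp_all add: mult.assoc principal_coeff_def del: of_nat_Suc)
  qed
  have "(\<lambda>n. laurent_deriv_term a q0 q (int n)) sums
      power_series_deriv (\<lambda>n. a (int n)) z 1"
    unfolding reg using z(2) by (intro power_series_deriv_sums [OF regular]) (simp add: z_def)
  moreover have "(\<lambda>n. laurent_deriv_term a q0 q (- int (Suc n))) sums
      (- power_series_deriv (principal_coeff a) w (w * w))"
    unfolding prin
    using power_series_deriv_sums [OF principal nz(2), of "w * w"]
      sums_Suc_iff [of "\<lambda>n. principal_coeff a n * power_deriv n w (w * w)"]
    by (intro sums_minus) (simp del: power_deriv.simps(2))
  ultimately show ?thesis
    unfolding int_sums_def laurent_total_deriv_def z_def [symmetric] w_def [symmetric]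
    by (intro exI conjI) auto
qed

end


section \<open>The HR derivative near the real axis\<close>

theorem theorem2:
  fixes f :: "quat \<Rightarrow> quat" and a :: "int \<Rightarrow> quat" and q0 :: quat and R1 R2 :: real
  assumes "R1 > 0" and "R2 > 0"
    and series: "\<And>q. R1 \<le> norm (q - q0) \<Longrightarrow> norm (q - q0) \<le> R2 \<Longrightarrow>
                   int_sums (laurent_term a q0 q) (f q)"
    and real: "q0 \<in> \<real>"
  shows "(\<forall>q. R1 < norm (q - q0) \<and> norm (q - q0) < R2 \<longrightarrow>
            has_partial_derivs f q \<and> int_summable (laurent_deriv_term a q0 q)) \<and>
         (\<forall>x\<in>\<real>. R1 < norm (x - q0) \<and> norm (x - q0) < R2 \<longrightarrow>
            ((\<lambda>q. HR_deriv f q - laurent_deriv a q0 q) \<longlongrightarrow> 0) (at x) \<and>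
            (HR_deriv f \<longlongrightarrow> laurent_deriv a q0 x) (at x))"
proof (cases "R1 < R2")
  case False
  then show ?thesis by (meson less_trans)
next
  case True
  define A where "A = {q. R1 < norm (q - q0) \<and> norm (q - q0) < R2}"
  define D where "D = (\<lambda>q. laurent_total_deriv a (q - q0))"
  \<comment> \<open>Any point of each bounding sphere would do; convergence there bounds the coefficients.\<close>
  have circle: "int_sums (laurent_term a q0 (q0 + of_real r)) (f (q0 + of_real r))"
    if "r = R1 \<or> r = R2" for r
    using that True assms(1,2) by (intro series) auto
  interpret laurent_annulus a "of_real R2" "of_real R1"
    using circle [of R1] circle [of R2] assms(1)
    by unfold_locales (auto simp: int_sums_laurent_term_iff sums_iff)
  have annulus: "norm (of_real R1 :: quat) < norm (q - q0)"
    "norm (q - q0) < norm (of_real R2 :: quat)" if "q \<in> A" for q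
    using that assms(1,2) by (auto simp: A_def)
  have "open A"
    unfolding A_def by (intro open_Collect_conj open_Collect_less continuous_intros)
  have f_eq: "power_series (\<lambda>n. a (int n)) (q - q0)
      + power_series (principal_coeff a) (inverse (q - q0)) = f q" if "q \<in> A" for q
    using series [of q] that
    by (auto simp: A_def int_sums_laurent_term_iff power_series_def sums_iff)
  have deriv: "(f has_derivative D q) (at q)" if "q \<in> A" for q
  proof (rule has_derivative_transform_within_open [OF _ \<open>open A\<close> that f_eq])
    have "((\<lambda>q. q - q0) has_derivative (\<lambda>h. h)) (at q)"
      by (auto intro!: derivative_eq_intros)
    from has_derivative_compose [OF this has_derivative_laurent [OF annulus [OF that]]]
    show "((\<lambda>q. power_series (\<lambda>n. a (int n)) (q - q0)
        + power_series (principal_coeff a) (inverse (q - q0))) has_derivative D q) (at q)"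
      by (simp add: D_def)
  qed
  have sums: "int_sums (laurent_deriv_term a q0 q) (D q 1)" if "q \<in> A" for q
    unfolding D_def by (rule int_sums_laurent_deriv_term [OF annulus [OF that]])
  have laurent_eq: "laurent_deriv a q0 q = D q 1" if "q \<in> A" for q
    unfolding laurent_deriv_def by (rule int_suminf_eqI [OF sums [OF that]])
  have limits: "((\<lambda>q. HR_deriv f q - laurent_deriv a q0 q) \<longlongrightarrow> 0) (at x)"
    "(HR_deriv f \<longlongrightarrow> laurent_deriv a q0 x) (at x)" if x: "x \<in> \<real>" "x \<in> A" for x
  proof -
    have "isCont (\<lambda>q. D q h) x" for h
      unfolding D_def
      by (rule isCont_o2 [where f = "\<lambda>q. q - q0", OF _ isCont_laurent_total_deriv [OF annulus [OF x(2)]]])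
        (intro continuous_intros)
    then have cont: "((\<lambda>q. D q h) \<longlongrightarrow> D x h) (at x)" for h
      by (simp add: isCont_def)
    have near: "\<forall>\<^sub>F q in at x. q \<in> A"
      using \<open>open A\<close> x(2) by (rule eventually_at_in_open')
    have "x - q0 \<in> \<real>" using x(1) real by (rule Reals_diff)
    then have "D x h = D x 1 * h" for h
      unfolding D_def by (rule laurent_total_deriv_real [OF annulus [OF x(2)]])
    then have at_x: "HR_deriv f x = laurent_deriv a q0 x"
      using HR_deriv_eq_real_partial [OF deriv] laurent_eq x(2) by metis
    have "((\<lambda>q. (1 / 4) *\<^sub>R (D q 1 - D q quat_i * quat_i - D q quat_j * quat_j
        - D q quat_k * quat_k)) \<longlongrightarrow> HR_deriv f x) (at x)"
      unfolding HR_deriv_eq [OF deriv [OF x(2)]] by (intro tendsto_intros cont)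
    then show HR: "(HR_deriv f \<longlongrightarrow> laurent_deriv a q0 x) (at x)"
      unfolding at_x
      by (rule Lim_transform_eventually)
        (use near in eventually_elim, simp add: HR_deriv_eq [OF deriv])
    have "(laurent_deriv a q0 \<longlongrightarrow> laurent_deriv a q0 x) (at x)"
      unfolding laurent_eq [OF x(2)] using cont
      by (rule Lim_transform_eventually) (use near in eventually_elim, simp add: laurent_eq)
    from tendsto_diff [OF HR this]
    show "((\<lambda>q. HR_deriv f q - laurent_deriv a q0 q) \<longlongrightarrow> 0) (at x)" by simp
  qed
  show ?thesis
    using has_derivative_imp_has_partial_derivs [OF deriv] sums limits
    unfolding A_def int_summable_def by blast
qed

end
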